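(* For all real numbers $a,b>0$ with $a\neq b$, writing $A=A(a,b)$, $G=G(a,b)$, $H=H(a,b)$, $L=L(a,b)$, $P=P(a,b)$, one has $$\left(\frac{2+G/A}{2+A/G}\right)^3<\frac{H}{A}<\left(\frac{2+G/A}{2+A/G}\right)^2$$ and $$\frac{G}{L}<\left(\frac{2}{1+A/G}\right)^{2/3}<\left(\frac{1+G/A}{2}\right)^{2/3}<\frac{P}{A}.$$
   Context: For $a,b>0$ with $a\neq b$: $A(a,b)=\frac{a+b}{2}$ (arithmetic mean), $G(a,b)=\sqrt{ab}$ (geometric mean), $H(a,b)=\frac{2ab}{a+b}$ (harmonic mean), $L(a,b)=\dfrac{a-b}{\log a-\log b}$ (logarithmic mean), and $P(a,b)=\dfrac{a-b}{2\arcsin\left(\frac{a-b}{a+b}\right)}$ (Seiffert mean). *)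

theory Defs
  imports Complex_Main
begin

definition arith_mean :: "real \<Rightarrow> real \<Rightarrow> real" where
  "arith_mean a b = (a + b) / 2"

definition geom_mean :: "real \<Rightarrow> real \<Rightarrow> real" where
  "geom_mean a b = sqrt (a * b)"

definition harm_mean :: "real \<Rightarrow> real \<Rightarrow> real" where
  "harm_mean a b = 2 * a * b / (a + b)"

text \<open>The next two formulas define the means for \<open>a \<noteq> b\<close> only; for \<open>a = b\<close> they return
  the value of a division by zero, not the usual continuous extension.\<close>

definition log_mean :: "real \<Rightarrow> real \<Rightarrow> real" where
  "log_mean a b = (a - b) / (ln a - ln b)"

definition seiffert_mean :: "real \<Rightarrow> real \<Rightarrow> real" where
  "seiffert_mean a b = (a - b) / (2 * arcsin ((a - b) / (a + b)))"

end

theory Submission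
  imports Defs
begin

text \<open>
  Each of the compared quantities is a function of \<open>x = G / A \<in> (0, 1)\<close>. Since \<open>H / A = x\<^sup>2\<close>,
  the first two bounds are rational in \<open>x\<close>; they reduce to \<open>(x - 1)\<^sup>3 (x + 1) < 0\<close> and to \<open>x < 1\<close>.
  The middle bound of the second chain compares powers of the harmonic and arithmetic means of \<open>1\<close>
  and \<open>x\<close>, and reduces to \<open>(1 - x)\<^sup>2 > 0\<close>.

  The Seiffert and logarithmic means become elementary after a substitution. By symmetry let
  \<open>b < a\<close>, and put \<open>x = cos t\<close> with \<open>sin t = (a - b) / (a + b)\<close>; then \<open>P / A = sin t / t\<close>. Similarly put
  \<open>1 / x = cosh s\<close> with \<open>2 s = ln a - ln b\<close>; then \<open>G / L = s / sinh s\<close>. Half-angle formulas with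
  \<open>u = t / 2\<close> and \<open>u = s / 2\<close> turn the two remaining bounds into the classical inequalities
  \<open>sin u / u > (cos u)\<^bsup>1/3\<^esup>\<close> (Adamovic and Mitrinovic) and \<open>sinh u / u > (cosh u)\<^bsup>1/3\<^esup>\<close>
  (Lazarevic). Both of these follow by differentiation: \<open>sin u (cos u)\<^bsup>-1/3\<^esup>\<close> and
  \<open>sinh u (cosh u)\<^bsup>-1/3\<^esup>\<close> both have derivative, with \<open>y = cos u\<close> or \<open>y = cosh u\<close> respectively,
  \<open>(2 y\<^bsup>2/3\<^esup> + y\<^bsup>-4/3\<^esup>) / 3\<close>, a weighted arithmetic mean whose geometric mean is \<open>1\<close>.
\<close>

section \<open>The inequalities of Adamovic--Mitrinovic and Lazarevic\<close>

text \<open>With \<open>c = y powr (2/3)\<close> this is \<open>2 c + 1 / c\<^sup>2 > 3\<close>, that is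
  \<open>(c - 1)\<^sup>2 (2 c + 1) > 0\<close>.\<close>

lemma weighted_powr_mean_gt_1:
  fixes y :: real
  assumes "y > 0" "y \<noteq> 1"
  shows "1 < 2/3 * y powr (2/3) + 1/3 * y powr (-4/3)"
proof -
  define c where "c = y powr (2/3)"
  have c: "c > 0" using assms by (simp add: c_def)
  have "c \<noteq> 1"
  proof
    assume "c = 1"
    moreover have "c powr (3/2) = y" using assms by (simp add: c_def powr_powr)
    ultimately show False using assms by simp
  qed
  then have "0 < (c - 1)^2 * (2 * c + 1)" using c by (intro mult_pos_pos) auto
  then have "3 * c^2 < 2 * c^3 + 1" by (simp add: algebra_simps power2_eq_square power3_eq_cube)
  then have "1 < 2/3 * c + 1/3 * (1 / c^2)"
    using c by (simp add: field_simps power2_eq_square power3_eq_cube)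
  moreover have "c^2 * y powr (-4/3) = 1"
    using assms by (simp add: c_def power2_eq_square flip: powr_add)
  then have "y powr (-4/3) = 1 / c^2" using c by (simp add: field_simps)
  ultimately show ?thesis by (simp add: c_def)
qed

text \<open>Dividing by the power of the cosine isolates \<open>u\<close>: the derivative of the difference
  \<open>sin u (cos u)\<^bsup>-1/3\<^esup> - u\<close> depends on \<open>cos u\<close> alone, and the difference vanishes at \<open>0\<close>.\<close>

lemma times_cos_powr_less_sin:
  fixes u :: real
  assumes "0 < u" "u < pi / 2"
  shows "u * cos u powr (1/3) < sin u"
proof -
  define f where "f = (\<lambda>u::real. sin u * cos u powr (-1/3) - u)"
  have cos_pos: "cos z > 0" if "0 \<le> z" "z \<le> u" for z
    using that assms by (intro cos_gt_zero_pi) auto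
  have "f 0 < f u"
  proof (rule DERIV_pos_imp_increasing_open[OF assms(1)])
    fix z assume z: "0 < z" "z < u"
    define y where "y = cos z"
    have y: "y > 0" using cos_pos z by (simp add: y_def)
    have "y < 1" using cos_monotone_0_pi[of 0 z] z assms by (simp add: y_def)
    have "(f has_real_derivative
        y * y powr (-1/3) + (sin z)^2 * (1/3) * y powr (-4/3) - 1) (at z)"
      unfolding f_def y_def
      by (rule derivative_eq_intros refl cos_pos | use z in \<open>simp add: power2_eq_square\<close>)+
    moreover have "y * y powr (-1/3) = y powr (2/3)"
      using y powr_add[of y 1 "-1/3"] by simp
    moreover have "y^2 * y powr (-4/3) = y powr (2/3)"
      using y powr_add[of y 2 "-4/3"] by simp
    moreover have "(sin z)^2 = 1 - y^2" by (simp add: y_def sin_squared_eq)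
    ultimately have "(f has_real_derivative
        2/3 * y powr (2/3) + 1/3 * y powr (-4/3) - 1) (at z)"
      by (simp add: algebra_simps)
    then show "\<exists>d. (f has_real_derivative d) (at z) \<and> 0 < d"
      using weighted_powr_mean_gt_1[OF y] \<open>y < 1\<close> by force
  next
    show "continuous_on {0..u} f"
      unfolding f_def by (intro continuous_intros) (use cos_pos in force)+
  qed
  then have "u < sin u * cos u powr (-1/3)" by (simp add: f_def)
  then have "u * cos u powr (1/3) < sin u * cos u powr (-1/3) * cos u powr (1/3)"
    using cos_pos[of u] assms by (intro mult_strict_right_mono) auto
  then show ?thesis using cos_pos[of u] assms by (simp add: mult.assoc flip: powr_add)
qed

text \<open>The hyperbolic case has the same derivative in \<open>y = cosh u\<close>: the derivative of \<open>cosh\<close> and the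
  identity for \<open>(sinh u)\<^sup>2\<close> each differ in sign from the circular case, and the signs cancel.\<close>

lemma times_cosh_powr_less_sinh:
  fixes u :: real
  assumes "0 < u"
  shows "u * cosh u powr (1/3) < sinh u"
proof -
  define f where "f = (\<lambda>u::real. sinh u * cosh u powr (-1/3) - u)"
  have "f 0 < f u"
  proof (rule DERIV_pos_imp_increasing_open[OF assms(1)])
    fix z assume z: "0 < z" "z < u"
    define y where "y = cosh z"
    have y: "y > 0" by (simp add: y_def)
    have "y > 1" using cosh_real_strict_mono[of 0 z] z by (simp add: y_def)
    have "(f has_real_derivative
        y * y powr (-1/3) - (sinh z)^2 * (1/3) * y powr (-4/3) - 1) (at z)"
      unfolding f_def y_def
      by (rule derivative_eq_intros refl cosh_real_pos | simp)+
         (simp add: field_simps powr_minus powr_diff power2_eq_square)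
    moreover have "y * y powr (-1/3) = y powr (2/3)"
      using y powr_add[of y 1 "-1/3"] by simp
    moreover have "y^2 * y powr (-4/3) = y powr (2/3)"
      using y powr_add[of y 2 "-4/3"] by simp
    moreover have "(sinh z)^2 = y^2 - 1" by (simp add: y_def cosh_square_eq)
    ultimately have "(f has_real_derivative
        2/3 * y powr (2/3) + 1/3 * y powr (-4/3) - 1) (at z)"
      by (simp add: algebra_simps)
    then show "\<exists>d. (f has_real_derivative d) (at z) \<and> 0 < d"
      using weighted_powr_mean_gt_1[OF y] \<open>y > 1\<close> by force
  next
    show "continuous_on {0..u} f"
      unfolding f_def by (intro continuous_intros) auto
  qed
  then have "u < sinh u * cosh u powr (-1/3)" by (simp add: f_def)
  then have "u * cosh u powr (1/3) < sinh u * cosh u powr (-1/3) * cosh u powr (1/3)"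
    by (intro mult_strict_right_mono) auto
  then show ?thesis by (simp add: mult.assoc flip: powr_add)
qed

section \<open>Doubling the argument\<close>

lemma square_powr_two_thirds:
  fixes y :: real
  assumes "y > 0"
  shows "(y^2) powr (2/3) = y * y powr (1/3)"
proof -
  have "(y^2) powr (2/3) = (y powr 2) powr (2/3)" using assms by simp
  also have "\<dots> = y powr (1 + 1/3)" by (simp only: powr_powr) simp
  also have "\<dots> = y * y powr (1/3)" using assms by (simp only: powr_add) simp
  finally show ?thesis .
qed

text \<open>With \<open>u = t / 2\<close> the left side is \<open>(cos u)\<^bsup>4/3\<^esup>\<close> and the right side is
  \<open>cos u (sin u / u)\<close>, so one factor \<open>cos u\<close> cancels.\<close>

lemma half_one_plus_cos_powr_less:
  fixes t :: real
  assumes "0 < t" "t < pi"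
  shows "((1 + cos t) / 2) powr (2/3) < sin t / t"
proof -
  define u where "u = t / 2"
  have u: "0 < u" "u < pi / 2" and t: "t = 2 * u" using assms by (auto simp: u_def)
  have cos_pos: "cos u > 0" using u by (intro cos_gt_zero_pi) auto
  have "(1 + cos t) / 2 = (cos u)^2" by (simp add: t cos_double_cos)
  then have "((1 + cos t) / 2) powr (2/3) = cos u * cos u powr (1/3)"
    using square_powr_two_thirds cos_pos by simp
  also have "\<dots> < cos u * (sin u / u)"
    using times_cos_powr_less_sin[OF u] u cos_pos by (simp add: field_simps)
  also have "\<dots> = sin t / t" by (simp add: t sin_double)
  finally show ?thesis .
qed

lemma arg_over_sinh_less:
  fixes s :: real
  assumes "0 < s"
  shows "s / sinh s < (2 / (1 + cosh s)) powr (2/3)"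
proof -
  define u where "u = s / 2"
  have u: "0 < u" and s: "s = 2 * u" using assms by (auto simp: u_def)
  have "(1 + cosh s) / 2 = (cosh u)^2" by (simp add: s cosh_double_cosh)
  then have "2 / (1 + cosh s) = 1 / (cosh u)^2" by (simp add: field_simps)
  then have "(2 / (1 + cosh s)) powr (2/3) = 1 / (cosh u * cosh u powr (1/3))"
    using square_powr_two_thirds[of "cosh u"] by (simp add: powr_divide)
  moreover have "s / sinh s = u / (sinh u * cosh u)" by (simp add: s sinh_double)
  moreover have "u / (sinh u * cosh u) < 1 / (cosh u * cosh u powr (1/3))"
    using times_cosh_powr_less_sinh[OF u] u by (simp add: field_simps)
  ultimately show ?thesis by simp
qed

section \<open>The means as functions of one parameter\<close>

lemma arith_mean_commute: "arith_mean a b = arith_mean b a"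
  by (simp add: arith_mean_def add.commute)

lemma geom_mean_commute: "geom_mean a b = geom_mean b a"
  by (simp add: geom_mean_def mult.commute)

lemma seiffert_mean_commute:
  assumes "a > 0" "b > 0"
  shows "seiffert_mean a b = seiffert_mean b a"
proof -
  have "(a - b) / (a + b) = - ((b - a) / (b + a))"
    by (simp add: add.commute minus_divide_left)
  moreover have "arcsin (- ((b - a) / (b + a))) = - arcsin ((b - a) / (b + a))"
    by (rule arcsin_minus) (use assms in \<open>simp_all add: field_simps\<close>)
  ultimately have "arcsin ((a - b) / (a + b)) = - arcsin ((b - a) / (b + a))"
    by (simp only:)
  then show ?thesis unfolding seiffert_mean_def
    by (metis minus_diff_eq minus_divide_divide mult_minus_right)
qed

lemma log_mean_commute: "log_mean a b = log_mean b a"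
  unfolding log_mean_def by (metis minus_diff_eq minus_divide_divide)

text \<open>The triangle with legs \<open>G\<close>, \<open>(a - b) / 2\<close> and hypotenuse \<open>A\<close> has the angle
  \<open>t = arcsin ((a - b) / (a + b))\<close> opposite to \<open>(a - b) / 2\<close>. Hence \<open>cos t = G / A\<close>, and
  \<open>P / A = sin t / t\<close>.\<close>

lemma seiffert_mean_bound:
  fixes a b :: real
  assumes "0 < b" "b < a"
  shows "((1 + geom_mean a b / arith_mean a b) / 2) powr (2/3)
    < seiffert_mean a b / arith_mean a b"
proof -
  define r where "r = (a - b) / (a + b)"
  define t where "t = arcsin r"
  have r: "0 < r" "r < 1" using assms by (auto simp: r_def)
  have t: "0 < t" "t < pi"
    using arcsin_less_mono[of 0 r] arcsin_bounded[of r] pi_gt_zero r unfolding t_def by auto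
  have sin: "sin t = r" using r by (simp add: t_def)
  have "4 * (a * b) = (a + b)^2 - (a - b)^2" by (simp add: power2_eq_square algebra_simps)
  then have "1 - r^2 = 4 * (a * b) / (a + b)^2"
    using assms by (simp add: r_def power_divide field_simps)
  moreover have "cos t = sqrt (1 - r^2)" using r by (simp add: t_def cos_arcsin)
  ultimately have "cos t = geom_mean a b / arith_mean a b"
    using assms by (simp add: geom_mean_def arith_mean_def real_sqrt_divide real_sqrt_mult)
  moreover have "a - b = r * (a + b)" using assms by (simp add: r_def)
  then have "seiffert_mean a b = r * (a + b) / (2 * t)"
    by (simp add: seiffert_mean_def t_def flip: r_def)
  then have "sin t / t = seiffert_mean a b / arith_mean a b"
    unfolding sin using assms t by (simp add: arith_mean_def field_simps)
  ultimately show ?thesis using half_one_plus_cos_powr_less[OF t] by simp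
qed

text \<open>Scaling by \<open>G\<close> gives \<open>a = G exp s\<close> and \<open>b = G exp (- s)\<close>, where \<open>2 s = ln a - ln b\<close>. Hence
  \<open>A / G = cosh s\<close>, \<open>(a - b) / (2 G) = sinh s\<close>, and \<open>G / L = s / sinh s\<close>.\<close>

lemma log_mean_bound:
  fixes a b :: real
  assumes "0 < b" "b < a"
  shows "geom_mean a b / log_mean a b
    < (2 / (1 + arith_mean a b / geom_mean a b)) powr (2/3)"
proof -
  define s where "s = (ln a - ln b) / 2"
  have s: "s > 0" using assms by (simp add: s_def)
  define p q where "p = sqrt a" and "q = sqrt b"
  have pq: "p > 0" "q > 0" and ab: "a = p^2" "b = q^2" using assms by (auto simp: p_def q_def)
  have G: "geom_mean a b = p * q" by (simp add: geom_mean_def real_sqrt_mult p_def q_def)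
  have "s = ln (p / q)" using pq by (simp add: s_def ab ln_realpow ln_div)
  then have e: "exp s = p / q" using pq by simp
  then have "exp (- s) = q / p" by (simp add: exp_minus)
  with e have "cosh s = arith_mean a b / geom_mean a b" "sinh s = (a - b) / (2 * geom_mean a b)"
    unfolding cosh_def sinh_def G using pq
    by (auto simp: arith_mean_def ab field_simps power2_eq_square)
  moreover from this have "s / sinh s = geom_mean a b / log_mean a b"
    using assms by (simp add: s_def log_mean_def)
  ultimately show ?thesis using arg_over_sinh_less[OF s] by simp
qed

lemma geom_mean_less_arith_mean:
  assumes "a > 0" "b > 0" "a \<noteq> b"
  shows "geom_mean a b < arith_mean a b"
proof -
  have "0 < (sqrt a - sqrt b)^2" using assms by simp
  also have "\<dots> = a + b - 2 * sqrt (a * b)"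
    using assms by (simp add: power2_diff real_sqrt_mult)
  finally show ?thesis by (simp add: geom_mean_def arith_mean_def)
qed

theorem theorem1p8:
  fixes a b A G H L P :: real
  assumes "a > 0" and "b > 0" and "a \<noteq> b"
    and "A = arith_mean a b" and "G = geom_mean a b" and "H = harm_mean a b"
    and "L = log_mean a b" and "P = seiffert_mean a b"
  shows "((2 + G / A) / (2 + A / G)) ^ 3 < H / A
    \<and> H / A < ((2 + G / A) / (2 + A / G)) ^ 2
    \<and> G / L < (2 / (1 + A / G)) powr (2 / 3)
    \<and> (2 / (1 + A / G)) powr (2 / 3) < ((1 + G / A) / 2) powr (2 / 3)
    \<and> ((1 + G / A) / 2) powr (2 / 3) < P / A"
proof -
  have pos: "A > 0" "G > 0" using assms by (auto simp: arith_mean_def geom_mean_def)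
  define x where "x = G / A"
  have x: "0 < x" "x < 1"
    using pos geom_mean_less_arith_mean[of a b] assms by (auto simp: x_def)
  have AG: "A / G = 1 / x" by (simp add: x_def)
  have HA: "H / A = x^2"
    using assms(1,2) unfolding x_def assms(4-6)
    by (simp add: harm_mean_def arith_mean_def geom_mean_def power_divide)
       (simp add: field_simps power2_eq_square)
  have quot: "(2 + G / A) / (2 + A / G) = x * ((2 + x) / (2 * x + 1))"
    unfolding AG x_def[symmetric] using x by (simp add: field_simps)
  have "(x * ((2 + x) / (2 * x + 1)))^3 < x^2"
  proof -
    (* The product below is the expansion of x * (2 + x)^3 - (2 * x + 1)^3. *)
    have "(x - 1)^3 * (x + 1) < 0"
      using x by (intro mult_neg_pos) (auto simp: power_less_zero_eq)
    then have "x * (2 + x)^3 < (2 * x + 1)^3"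
      by (simp add: power2_eq_square power3_eq_cube algebra_simps)
    then have "x * ((2 + x) / (2 * x + 1))^3 < 1" using x by (simp add: power_divide)
    then have "x^2 * (x * ((2 + x) / (2 * x + 1))^3) < x^2 * 1"
      using x by (intro mult_strict_left_mono) auto
    then show ?thesis by (simp add: power_mult_distrib power2_eq_square power3_eq_cube mult_ac)
  qed
  moreover have "x^2 < (x * ((2 + x) / (2 * x + 1)))^2"
    using x by (intro power_strict_mono) (auto simp: field_simps)
  moreover have "G / L < (2 / (1 + A / G)) powr (2 / 3)"
    using log_mean_bound[of a b] log_mean_bound[of b a] assms(1-3) unfolding assms(4,5,7)
    by (cases "a < b") (auto simp: log_mean_commute geom_mean_commute arith_mean_commute)
  moreover have "(2 / (1 + A / G)) powr (2 / 3) < ((1 + G / A) / 2) powr (2 / 3)"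
  proof (rule powr_less_mono2)
    have "0 < (1 - x)^2" using x by simp
    then show "2 / (1 + A / G) < (1 + G / A) / 2"
      unfolding AG x_def[symmetric] using x by (simp add: field_simps power2_eq_square)
  qed (use pos in auto)
  moreover have "((1 + G / A) / 2) powr (2 / 3) < P / A"
    using seiffert_mean_bound[of a b] seiffert_mean_bound[of b a] assms(1-3) unfolding assms(4,5,8)
    by (cases "a < b") (auto simp: seiffert_mean_commute geom_mean_commute arith_mean_commute)
  ultimately show ?thesis unfolding HA quot by blast
qed

end
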